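(* Let $(X,\mathcal{T})$ and $(X',\mathcal{T}')$ be topological spaces, $f:(X,\mathcal{T})\to(X',\mathcal{T}')$ a map, $\mathcal{P}$ a subbase for $\mathcal{T}$, $\mathcal{P}'$ a subbase for $\mathcal{T}'$, and suppose that $f^{-1}(U')\in\mathcal{P}$ for every $U'\in\mathcal{P}'$. Let $\mathcal{M}$ be a family of non-empty subsets of $X$ and $\mathcal{M}'=CL(X')$. Let $\mathcal{O}=\mathcal{O}_{\mathcal{P}}^{\mathcal{M}}$ and $\mathcal{O}'=\mathcal{O}_{\mathcal{P}'}^{\mathcal{M}'}$. Then the map $2^f:(\mathcal{M},\mathcal{O})\to(\mathcal{M}',\mathcal{O}')$, defined by $2^f(C)=\overline{f(C)}^{X'}$ for every $C\in\mathcal{M}$, is continuous.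
   Context: For a topological space $Y$, $CL(Y)$ is the set of all non-empty closed subsets of $Y$, and $\overline{B}^{Y}$ is the closure of $B$ in $Y$. For a set $Y$, a family $\mathcal{N}$ of non-empty subsets of $Y$ and $A\subseteq Y$, put $A_{\mathcal{N}}^-=\{N\in\mathcal{N}\mid N\cap A\neq\emptyset\}$. For a family $\mathcal{S}$ of subsets of $Y$ such that every $N\in\mathcal{N}$ meets $\bigcup\mathcal{S}$, $\mathcal{O}_{\mathcal{S}}^{\mathcal{N}}$ denotes the topology on $\mathcal{N}$ having $\{A_{\mathcal{N}}^-\mid A\in\mathcal{S}\}$ as a subbase. A subbase for a topology on $Y$ is a family of open sets whose finite (non-empty) intersections form a base; in particular its union is $Y$. *)

theory Defs
  imports "HOL-Analysis.Analysis"
begin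

(* finite' admits only non-empty finite families, so no intersection over the empty family
   is used and the union of a subbase is the whole space. *)
definition subbase_of :: "'a topology \<Rightarrow> 'a set set \<Rightarrow> bool" where
  "subbase_of X P \<longleftrightarrow>
     (\<forall>S\<in>P. openin X S) \<and>
     (\<forall>U. openin X U \<longrightarrow> (arbitrary union_of (finite' intersection_of (\<lambda>S. S \<in> P))) U)"

definition CL :: "'a topology \<Rightarrow> 'a set set" where
  "CL Y = {C. closedin Y C \<and> C \<noteq> {}}"

definition hit_set :: "'a set set \<Rightarrow> 'a set \<Rightarrow> 'a set set" where
  "hit_set N A = {C \<in> N. C \<inter> A \<noteq> {}}"

(* The space underlying topology_generated_by is the union of the generators. It equals N exactly
   when every member of N meets the union of S; see topspace_hit_topology and
   subbase_of_hit_topology. *)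
definition hit_topology :: "'a set set \<Rightarrow> 'a set set \<Rightarrow> 'a set topology" where
  "hit_topology S N = topology_generated_by (hit_set N ` S)"

definition hyper_map :: "'b topology \<Rightarrow> ('a \<Rightarrow> 'b) \<Rightarrow> 'a set \<Rightarrow> 'b set" where
  "hyper_map Y f C = Y closure_of (f ` C)"

lemma Union_subbase_of:
  assumes "subbase_of X P"
  shows "\<Union>P = topspace X"
proof
  show "\<Union>P \<subseteq> topspace X"
    using assms openin_subset by (fastforce simp: subbase_of_def)
  have "(arbitrary union_of (finite' intersection_of (\<lambda>S. S \<in> P))) (topspace X)"
    using assms by (simp add: subbase_of_def)
  then obtain \<U> where U: "\<Union>\<U> = topspace X"
    and int: "\<And>S. S \<in> \<U> \<Longrightarrow> (finite' intersection_of (\<lambda>S. S \<in> P)) S"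
    by (auto simp: union_of_def)
  have "S \<subseteq> \<Union>P" if "S \<in> \<U>" for S
    using int[OF that] unfolding intersection_of_def by blast
  then show "topspace X \<subseteq> \<Union>P"
    using U by blast
qed

lemma subbase_of_topology_generated_by:
  "subbase_of (topology_generated_by P) P"
proof -
  let ?Q = "arbitrary union_of (finite' intersection_of (\<lambda>S. S \<in> P))"
  have "?Q U" if "generate_topology_on P U" for U
    using that
  proof induction
    case Empty
    show ?case by (simp add: arbitrary_union_of_empty)
  next
    case (Int a b)
    have "\<forall>A B. ?Q A \<and> ?Q B \<longrightarrow> ?Q (A \<inter> B)"
      unfolding arbitrary_union_of_Int_eq
      by (intro allI impI arbitrary_union_of_inc finite'_intersection_of_Int) (erule conjunct1, erule conjunct2)
    with Int.IH show ?case by blast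
  next
    case (UN K)
    then show ?case by (intro arbitrary_union_of_Union) auto
  next
    case (Basis s)
    then have "(finite' intersection_of (\<lambda>S. S \<in> P)) s"
      by (simp add: finite'_intersection_of_inc)
    then show ?case by (rule arbitrary_union_of_inc)
  qed
  then show ?thesis
    by (auto simp: subbase_of_def openin_topology_generated_by_iff intro: generate_topology_on.Basis)
qed

lemma topspace_hit_topology:
  assumes "\<And>C. C \<in> N \<Longrightarrow> C \<inter> \<Union>S \<noteq> {}"
  shows "topspace (hit_topology S N) = N"
  using assms by (fastforce simp: hit_topology_def hit_set_def)

lemma subbase_of_hit_topology:
  "subbase_of (hit_topology S N) (hit_set N ` S)"
  by (simp add: hit_topology_def subbase_of_topology_generated_by)

end

theory Submission
  imports Defs
begin

text \<open>
  The topology on \<^term>\<open>CL X'\<close> is generated by the hit sets of members \<open>U\<close> of \<open>P'\<close>, so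
  continuity only has to be tested on these. An open set meets a closure iff it meets the set
  itself; hence the closure of \<open>f ` C\<close> hits \<open>U\<close> iff \<open>C\<close> hits the preimage of \<open>U\<close>. Thus the
  preimage of a generator is the hit set of a member of \<open>P\<close>, which is again a generator.
\<close>

lemma hyper_map_Int_open_eq_empty_iff:
  assumes "openin Y U" and "C \<subseteq> A"
  shows "hyper_map Y f C \<inter> U = {} \<longleftrightarrow> C \<inter> {x \<in> A. f x \<in> U} = {}"
proof -
  have "hyper_map Y f C \<inter> U = {} \<longleftrightarrow> U \<inter> f ` C = {}"
    using openin_Int_closure_of_eq_empty[OF assms(1)] by (simp add: hyper_map_def Int_commute)
  also have "\<dots> \<longleftrightarrow> C \<inter> {x \<in> A. f x \<in> U} = {}"
    using assms(2) by blast
  finally show ?thesis .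
qed

lemma hyper_map_in_CL:
  assumes "f ` C \<subseteq> topspace Y" and "C \<noteq> {}"
  shows "hyper_map Y f C \<in> CL Y"
  using assms closure_of_subset[of "f ` C" Y] by (auto simp: CL_def hyper_map_def)

text \<open>
  A subbase covers the space, so every non-empty subset meets one of its members; this rules out
  points of \<open>N\<close> lying outside the union of the generators.
\<close>

lemma topspace_hit_topology_subbase:
  assumes "subbase_of Y S" and "\<And>C. C \<in> N \<Longrightarrow> C \<subseteq> topspace Y \<and> C \<noteq> {}"
  shows "topspace (hit_topology S N) = N"
proof (rule topspace_hit_topology)
  fix C assume "C \<in> N"
  have "C \<subseteq> \<Union>S" and "C \<noteq> {}"
    using assms(2)[OF \<open>C \<in> N\<close>] Union_subbase_of[OF assms(1)] by simp_all
  then show "C \<inter> \<Union>S \<noteq> {}"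
    by blast
qed

theorem proposition3p1:
  fixes X :: "'a topology" and X' :: "'b topology" and f :: "'a \<Rightarrow> 'b"
    and P :: "'a set set" and P' :: "'b set set" and M :: "'a set set"
  assumes "f \<in> topspace X \<rightarrow> topspace X'"
    and "subbase_of X P"
    and "subbase_of X' P'"
    and "\<And>U'. U' \<in> P' \<Longrightarrow> {x \<in> topspace X. f x \<in> U'} \<in> P"
    and "\<And>C. C \<in> M \<Longrightarrow> C \<subseteq> topspace X \<and> C \<noteq> {}"
  shows "continuous_map (hit_topology P M) (hit_topology P' (CL X')) (hyper_map X' f)"
proof -
  have domain: "topspace (hit_topology P M) = M"
    using assms(2,5) by (rule topspace_hit_topology_subbase)
  have codomain: "topspace (hit_topology P' (CL X')) = CL X'"
    using assms(3) by (rule topspace_hit_topology_subbase) (simp add: CL_def closedin_subset)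
  have maps_to: "hyper_map X' f C \<in> CL X'" if "C \<in> M" for C
    using assms(1) assms(5)[OF that] by (intro hyper_map_in_CL) blast+
  have preimage: "hyper_map X' f -` hit_set (CL X') U \<inter> M = hit_set M {x \<in> topspace X. f x \<in> U}"
    if "U \<in> P'" for U
  proof -
    have "openin X' U"
      using assms(3) that by (simp add: subbase_of_def)
    then have "hyper_map X' f C \<in> hit_set (CL X') U \<longleftrightarrow> C \<in> hit_set M {x \<in> topspace X. f x \<in> U}"
      if "C \<in> M" for C
      unfolding hit_set_def mem_Collect_eq
      using hyper_map_Int_open_eq_empty_iff[of X' U C "topspace X" f] maps_to[OF that] assms(5)[OF that] that
      by metis
    then show ?thesis
      by (auto simp: hit_set_def)
  qed
  show ?thesis
    unfolding hit_topology_def[of P']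
  proof (rule continuous_on_generated_topo)
    fix V assume "V \<in> hit_set (CL X') ` P'"
    then obtain U where "U \<in> P'" and V: "V = hit_set (CL X') U"
      by blast
    have "openin (hit_topology P M) (hit_set M {x \<in> topspace X. f x \<in> U})"
      using assms(4)[OF \<open>U \<in> P'\<close>] by (auto simp: hit_topology_def intro: topology_generated_by_Basis)
    then show "openin (hit_topology P M) (hyper_map X' f -` V \<inter> topspace (hit_topology P M))"
      by (simp add: V domain preimage[OF \<open>U \<in> P'\<close>])
  next
    have "\<Union>(hit_set (CL X') ` P') = CL X'"
      using codomain by (simp add: hit_topology_def)
    then show "hyper_map X' f ` topspace (hit_topology P M) \<subseteq> \<Union>(hit_set (CL X') ` P')"
      using maps_to by (auto simp: domain)
  qed
qed

end
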